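(* Let $\rho$ and $\sigma$ be two non-product two-qubit states (density operators on $\mathbb C^2\otimes\mathbb C^2$, neither of which is of the form $\rho_A\otimes\rho_B$). Suppose that, for every pair of local binary projective measurements, $$Q_\rho(\mathbf x,\mathbf y)=Q_\sigma(\mathbf x,\mathbf y)\qquad\text{for all } \mathbf x,\mathbf y\in S^2.$$ Then $$\sigma=\rho\quad\text{or}\quad \sigma=\widetilde\rho,$$ where $$\widetilde\rho=(\sigma_y\otimes\sigma_y)\,\rho^*\,(\sigma_y\otimes\sigma_y)$$ is the double spin flip of $\rho$. Hence every non-product two-qubit state, including pure entangled states and rank-deficient mixed states, is determined by the function $(\mathbf x,\mathbf y)\mapsto Q_\rho(\mathbf x,\mathbf y)$ on $S^2\times S^2$ among non-product two-qubit states, up to this discrete ambiguity $\rho\leftrightarrow\widetilde\rho$.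
   Context: A two-qubit state is a positive semidefinite operator of trace one on $\mathbb C^2\otimes\mathbb C^2$; it is a product state if it equals $\rho_A\otimes\rho_B$ for single-qubit states $\rho_A,\rho_B$, and non-product otherwise. $\boldsymbol\sigma=(\sigma_x,\sigma_y,\sigma_z)$ are the Pauli matrices, $S^2\subset\mathbb R^3$ is the unit sphere, and $\rho^*$ is the entrywise complex conjugate of $\rho$ in the computational (product of $\sigma_z$-eigenbases) basis. For $\mathbf x,\mathbf y\in S^2$ and $s,t\in\{+1,-1\}$, the local binary projectors are $$\Pi_s^{(\mathbf x)}=\tfrac12(I+s\,\mathbf x\cdot\boldsymbol\sigma),\qquad \Pi_t^{(\mathbf y)}=\tfrac12(I+t\,\mathbf y\cdot\boldsymbol\sigma),$$ and the Born probability table of $\rho$ in the local context $(\mathbf x,\mathbf y)$ is $$p^{\rho}_{st}(\mathbf x,\mathbf y)=\operatorname{Tr}\!\left[\rho\,\bigl(\Pi_s^{(\mathbf x)}\otimes\Pi_t^{(\mathbf y)}\bigr)\right].$$ The margin-free dependence coordinate is $$Q_\rho(\mathbf x,\mathbf y)=\frac{p^\rho_{++}p^\rho_{--}-p^\rho_{+-}p^\rho_{-+}}{p^\rho_{++}p^\rho_{--}+p^\rho_{+-}p^\rho_{-+}},$$ with all entries evaluated at $(\mathbf x,\mathbf y)$. For a non-product two-qubit state the denominator is strictly positive for every $(\mathbf x,\mathbf y)$, so $Q_\rho$ is well defined on all of $S^2\times S^2$. *)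

theory Defs
  imports "HOL-Analysis.Analysis"
begin

text \<open>
  Operators on the single-qubit space are matrices over the index type \<^typ>\<open>2\<close>, where the indices
  1 and 2 stand for the computational basis vectors. Operators on the tensor product of two
  qubits are matrices over the index type \<^typ>\<open>2 \<times> 2\<close>. An entry \<^term>\<open>A $ i $ j\<close> is the one
  in row \<^term>\<open>i\<close> and column \<^term>\<open>j\<close>.
\<close>

type_synonym qubit_op = "complex ^ 2 ^ 2"
type_synonym two_qubit_op = "complex ^ (2 \<times> 2) ^ (2 \<times> 2)"

definition kron :: "qubit_op \<Rightarrow> qubit_op \<Rightarrow> two_qubit_op" (infixr "\<otimes>\<^sub>m" 75)
  where "A \<otimes>\<^sub>m B = (\<chi> i j. A $ fst i $ fst j * B $ snd i $ snd j)"

definition conj_matrix :: "complex ^ 'n ^ 'm \<Rightarrow> complex ^ 'n ^ 'm"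
  where "conj_matrix A = (\<chi> i j. cnj (A $ i $ j))"

definition pauli_x :: qubit_op
  where "pauli_x = vector [vector [0, 1], vector [1, 0]]"

definition pauli_y :: qubit_op
  where "pauli_y = vector [vector [0, - \<i>], vector [\<i>, 0]]"

definition pauli_z :: qubit_op
  where "pauli_z = vector [vector [1, 0], vector [0, - 1]]"

text \<open>
  Over the complex numbers, reality of the quadratic form already forces the matrix to be
  Hermitian.
\<close>

definition pos_semidef :: "complex ^ 'n ^ 'n \<Rightarrow> bool"
  where "pos_semidef A \<longleftrightarrow>
    (\<forall>v. (\<Sum>i\<in>UNIV. cnj (v $ i) * (A *v v) $ i) \<in> \<real> \<and>
         0 \<le> Re (\<Sum>i\<in>UNIV. cnj (v $ i) * (A *v v) $ i))"

definition density_operator :: "complex ^ 'n ^ 'n \<Rightarrow> bool"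
  where "density_operator \<rho> \<longleftrightarrow> pos_semidef \<rho> \<and> trace \<rho> = 1"

definition product_state :: "two_qubit_op \<Rightarrow> bool"
  where "product_state \<rho> \<longleftrightarrow>
    (\<exists>\<rho>A \<rho>B. density_operator \<rho>A \<and> density_operator \<rho>B \<and> \<rho> = \<rho>A \<otimes>\<^sub>m \<rho>B)"

definition nonproduct_state :: "two_qubit_op \<Rightarrow> bool"
  where "nonproduct_state \<rho> \<longleftrightarrow> density_operator \<rho> \<and> \<not> product_state \<rho>"

definition local_projector :: "real \<Rightarrow> real ^ 3 \<Rightarrow> qubit_op"
  where "local_projector s x =
    (1/2) *\<^sub>R (mat 1 + s *\<^sub>R (x $ 1 *\<^sub>R pauli_x + x $ 2 *\<^sub>R pauli_y + x $ 3 *\<^sub>R pauli_z))"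

text \<open>
  The trace below is a real number whenever \<open>\<rho>\<close> is a density operator, since both factors are
  then Hermitian and positive semidefinite; \<^const>\<open>Re\<close> only changes the type.
\<close>

definition born_prob :: "two_qubit_op \<Rightarrow> real \<Rightarrow> real \<Rightarrow> real ^ 3 \<Rightarrow> real ^ 3 \<Rightarrow> real"
  where "born_prob \<rho> s t x y = Re (trace (\<rho> ** (local_projector s x \<otimes>\<^sub>m local_projector t y)))"

text \<open>
  The denominator is positive for nonproduct states and unit vectors \<open>x\<close>, \<open>y\<close>, so the
  convention for division by zero plays no role there.
\<close>

definition dep_coord :: "two_qubit_op \<Rightarrow> real ^ 3 \<Rightarrow> real ^ 3 \<Rightarrow> real"
  where "dep_coord \<rho> x y =
    (born_prob \<rho> 1 1 x y * born_prob \<rho> (-1) (-1) x y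
       - born_prob \<rho> 1 (-1) x y * born_prob \<rho> (-1) 1 x y) /
    (born_prob \<rho> 1 1 x y * born_prob \<rho> (-1) (-1) x y
       + born_prob \<rho> 1 (-1) x y * born_prob \<rho> (-1) 1 x y)"

definition spin_flip :: "two_qubit_op \<Rightarrow> two_qubit_op"
  where "spin_flip \<rho> = (pauli_y \<otimes>\<^sub>m pauli_y) ** conj_matrix \<rho> ** (pauli_y \<otimes>\<^sub>m pauli_y)"

end

theory Submission
  imports Defs
begin

text \<open>
  In Bloch coordinates \<open>(a, b, T)\<close> the dependence coordinate is \<open>2 x\<^sup>T C y / D(x, y)\<close> with
  \<open>C = T - a b\<^sup>T\<close> and \<open>D = 1 + (x\<^sup>T T y)\<^sup>2 - (a \<bullet> x)\<^sup>2 - (b \<bullet> y)\<^sup>2\<close>; the state is a product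
  exactly when \<open>C = 0\<close>, and \<open>D > 0\<close> otherwise. If two states have the same dependence
  coordinate, the bilinear forms of \<open>C\<close> and \<open>C'\<close> have the same zeros, so \<open>C' = l C\<close>, and by
  density \<open>D' = l D\<close> as homogeneous forms, where \<open>l > 0\<close>. This identity extends to complex \<open>x\<close>
  and \<open>y\<close>. On isotropic vectors (\<open>x\<^sup>T x = y\<^sup>T y = 0\<close>) it reads \<open>(x\<^sup>T T' y)\<^sup>2 = l (x\<^sup>T T y)\<^sup>2\<close>,
  which forces \<open>T' = \<plusminus>\<surd>l T\<close>; with only one of the vectors isotropic it then yields
  \<open>a' = \<plusminus>\<surd>l a\<close> and \<open>b' = \<plusminus>\<surd>l b\<close>, and finally \<open>l = 1\<close>. Since \<open>C' = C \<noteq> 0\<close>, the signs leave only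
  \<open>(a', b', T') = (a, b, T)\<close> and \<open>(-a, -b, T)\<close>, and the latter is the double spin flip.
\<close>

section \<open>Bilinear and biquadratic forms\<close>

text \<open>This is the bilinear pairing, without conjugation even over \<open>complex\<close>. It
  therefore has nonzero isotropic complex vectors, and one definition serves both the real forms and
  their complexifications.\<close>

definition dot :: "'a::comm_ring_1 ^ 'n \<Rightarrow> 'a ^ 'n \<Rightarrow> 'a"
  where "dot x y = (\<Sum>i\<in>UNIV. x $ i * y $ i)"

lemma dot_add_left: "dot (x + y) z = dot x z + dot y z"
  and dot_add_right: "dot z (x + y) = dot z x + dot z y"
  and dot_diff_left: "dot (x - y) z = dot x z - dot y z"
  and dot_diff_right: "dot z (x - y) = dot z x - dot z y"
  and dot_minus_left: "dot (- x) z = - dot x z"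
  and dot_minus_right: "dot z (- x) = - dot z x"
  and dot_smult_left: "dot (c *s x) z = c * dot x z"
  and dot_smult_right: "dot z (c *s x) = c * dot z x"
  by (simp_all add: dot_def algebra_simps sum.distrib sum_subtractf sum_negf sum_distrib_left)

lemma dot_zero [simp]: "dot 0 x = 0" "dot x 0 = 0"
  by (simp_all add: dot_def)

lemmas dot_simps = dot_add_left dot_add_right dot_diff_left dot_diff_right dot_minus_left
  dot_minus_right dot_smult_left dot_smult_right

lemma dot_commute: "dot x y = dot y x"
  by (simp add: dot_def mult.commute)

lemma dot_real: "dot x y = x \<bullet> (y :: real ^ 'n)"
  by (simp add: dot_def inner_vec_def)

lemma dot_axis: "dot (axis i 1) x = x $ i"
proof -
  have "dot (axis i 1) x = (\<Sum>j\<in>UNIV. if j = i then x $ j else 0)"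
    unfolding dot_def by (rule sum.cong) (auto simp: axis_def)
  then show ?thesis by simp
qed

lemma matrix_mult_axis: "((A :: 'a::comm_ring_1 ^ 'n ^ 'm) *v axis j 1) $ k = A $ k $ j"
proof -
  have "(A *v axis j 1) $ k = dot (axis j 1) (A $ k)"
    by (simp add: matrix_vector_mult_def dot_def mult.commute)
  then show ?thesis by (simp add: dot_axis)
qed

lemma dot_transpose: "dot x (A *v y) = dot y (transpose A *v x)"
  unfolding dot_def matrix_vector_mult_def transpose_def
  by (simp add: sum_distrib_left, subst sum.swap) (simp add: mult_ac)

text \<open>This is the denominator \<open>D\<close>, homogenised by the factors
  \<open>dot x x\<close> and \<open>dot y y\<close>. It is quadratic in each variable and makes
  sense for all vectors, real or complex.\<close>

definition dep_form ::
    "'a::comm_ring_1 ^ 'n \<Rightarrow> 'a ^ 'm \<Rightarrow> 'a ^ 'm ^ 'n \<Rightarrow> 'a ^ 'n \<Rightarrow> 'a ^ 'm \<Rightarrow> 'a"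
  where "dep_form a b T x y = dot x x * dot y y + (dot x (T *v y))\<^sup>2
    - (dot a x)\<^sup>2 * dot y y - (dot b y)\<^sup>2 * dot x x"

definition cov_form ::
    "'a::comm_ring_1 ^ 'n \<Rightarrow> 'a ^ 'm \<Rightarrow> 'a ^ 'm ^ 'n \<Rightarrow> 'a ^ 'n \<Rightarrow> 'a ^ 'm \<Rightarrow> 'a"
  where "cov_form a b T x y = dot x (T *v y) - dot a x * dot b y"

lemma mv_smult: "A *v (c *s x) = c *s (A *v (x :: 'a::comm_ring_1 ^ 'n))"
  by (simp add: vec_eq_iff matrix_vector_mult_def sum_distrib_left mult_ac)

lemma mv_minus: "A *v (- x) = - (A *v (x :: 'a::comm_ring_1 ^ 'n))"
  by (simp add: vec_eq_iff matrix_vector_mult_def sum_negf)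

lemma dep_form_scale: "dep_form a b T (c *s x) (d *s y) = c\<^sup>2 * d\<^sup>2 * dep_form a b T x y"
  by (simp add: dep_form_def mv_smult dot_simps power2_eq_square algebra_simps)

lemma cov_form_scale: "cov_form a b T (c *s x) (d *s y) = c * d * cov_form a b T x y"
  by (simp add: cov_form_def mv_smult dot_simps algebra_simps)

lemma cov_form_add_left: "cov_form a b T (x + x') y = cov_form a b T x y + cov_form a b T x' y"
  and cov_form_add_right: "cov_form a b T x (y + y') = cov_form a b T x y + cov_form a b T x y'"
  by (simp_all add: cov_form_def dot_simps matrix_vector_right_distrib algebra_simps)

lemma cov_form_smult_left: "cov_form a b T (c *s x) y = c * cov_form a b T x y"
  and cov_form_smult_right: "cov_form a b T x (c *s y) = c * cov_form a b T x y"
  by (simp_all add: cov_form_def mv_smult dot_simps algebra_simps)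

section \<open>Real bilinear forms: proportionality and density of nonzeros\<close>

lemma bilinear_cov_form: "bilinear (cov_form a b (T :: real ^ 'm ^ 'n))"
  unfolding bilinear_def
  by (intro conjI allI linearI; simp only: cov_form_add_left cov_form_add_right
    cov_form_smult_left cov_form_smult_right real_scaleR_def flip: scalar_mult_eq_scaleR)

text \<open>Choose \<open>l\<close> so that \<open>K = H - l G\<close> vanishes at a point where
  \<open>G\<close> does not. Since \<open>K\<close> also vanishes on all zeros of \<open>G\<close>,
  shifting one argument onto the zero set of \<open>G\<close> propagates \<open>K = 0\<close> to
  every pair.\<close>

lemma bilinear_proportional:
  fixes G H :: "'a::real_vector \<Rightarrow> 'b::real_vector \<Rightarrow> real"
  assumes G: "bilinear G" and H: "bilinear H"
    and zeros: "\<And>x y. G x y = 0 \<Longrightarrow> H x y = 0"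
  shows "\<exists>l. \<forall>x y. H x y = l * G x y"
proof (cases "\<exists>x y. G x y \<noteq> 0")
  case False
  then show ?thesis using zeros by (intro exI[of _ 0]) auto
next
  case True
  then obtain x0 y0 where nz: "G x0 y0 \<noteq> 0" by blast
  define l where "l = H x0 y0 / G x0 y0"
  define K where "K x y = H x y - l * G x y" for x y
  note bil = bilinear_ladd[OF G] bilinear_ladd[OF H] bilinear_radd[OF G] bilinear_radd[OF H]
    bilinear_lmul[OF G] bilinear_lmul[OF H] bilinear_rmul[OF G] bilinear_rmul[OF H]
  have Kz: "K x y = 0" if "G x y = 0" for x y using that zeros by (simp add: K_def)
  have K_rd: "K x (y + c *\<^sub>R y') = K x y + c * K x y'" for x y y' c
    by (simp add: K_def bil algebra_simps)
  have K_ld: "K (x + c *\<^sub>R x') y = K x y + c * K x' y" for x x' y c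
    by (simp add: K_def bil algebra_simps)
  have K0: "K x0 y0 = 0" using nz by (simp add: K_def l_def)
  \<comment> \<open>Subtracting the right multiple of \<open>y1\<close> from \<open>y\<close> lands
    on a zero of \<open>G\<close>; as \<open>K x y1 = 0\<close>, the shift leaves
    \<open>K x y\<close> unchanged.\<close>
  have step_r: "K x y = 0" if "G x y1 \<noteq> 0" "K x y1 = 0" for x y y1
  proof -
    have "G x (y + (- G x y / G x y1) *\<^sub>R y1) = 0" using that by (simp only: bil) simp
    from Kz[OF this] show ?thesis using that by (simp only: K_rd)
  qed
  have step_l: "K x y0 = 0" for x
  proof -
    have "G (x + (- G x y0 / G x0 y0) *\<^sub>R x0) y0 = 0" using nz by (simp only: bil) simp
    from Kz[OF this] show ?thesis using K0 by (simp only: K_ld)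
  qed
  have "K x y = 0" for x y
  proof (cases "G x y0 = 0")
    case False
    then show ?thesis using step_r step_l by blast
  next
    case True
    \<comment> \<open>When \<open>G x y0 = 0\<close>, moving \<open>x\<close> by \<open>x0\<close>
      makes the pairing with \<open>y0\<close> nonzero, so \<open>step_r\<close> applies to
      \<open>x + x0\<close> and to \<open>x0\<close>; the difference gives
      \<open>K x y = 0\<close>.\<close>
    then have "G (x + 1 *\<^sub>R x0) y0 \<noteq> 0" using nz by (simp only: bil) simp
    then have "K (x + 1 *\<^sub>R x0) y = 0" using step_r step_l by blast
    moreover have "K x0 y = 0" using step_r nz K0 by blast
    ultimately show ?thesis by (simp only: K_ld)
  qed
  then show ?thesis by (intro exI[of _ l]) (simp add: K_def)
qed

text \<open>Along the line through \<open>(x, y)\<close> in direction \<open>(x0, y0)\<close>,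
  \<open>G\<close> is a polynomial in \<open>t\<close> with nonzero leading coefficient
  \<open>G x0 y0\<close>. It has finitely many roots, so \<open>F\<close> vanishes for all small
  \<open>t\<close> other than 0, and continuity gives the value at 0.\<close>

lemma bilinear_nonzero_dense:
  fixes G F :: "'a::real_normed_vector \<Rightarrow> 'b::real_normed_vector \<Rightarrow> real"
  assumes G: "bilinear G" and nz: "G x0 y0 \<noteq> 0"
    and F0: "\<And>x y. G x y \<noteq> 0 \<Longrightarrow> F x y = 0"
    and cont: "\<And>x y x' y'. isCont (\<lambda>t. F (x + t *\<^sub>R x') (y + t *\<^sub>R y')) 0"
  shows "F x y = 0"
proof -
  define p where "p = [:G x y, G x y0 + G x0 y, G x0 y0:]"
  have p: "G (x + t *\<^sub>R x0) (y + t *\<^sub>R y0) = poly p t" for t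
    by (simp add: p_def bilinear_ladd[OF G] bilinear_radd[OF G] bilinear_lmul[OF G]
      bilinear_rmul[OF G] algebra_simps)
  have "finite {t. poly p t = 0}"
    using nz by (intro poly_roots_finite) (auto simp: p_def)
  then have "\<not> 0 islimpt {t. poly p t = 0}" by (rule islimpt_finite)
  then have "\<forall>\<^sub>F t in at 0. poly p t \<noteq> 0"
    by (simp add: islimpt_iff_eventually)
  then have "\<forall>\<^sub>F t in at 0. F (x + t *\<^sub>R x0) (y + t *\<^sub>R y0) = 0"
    by eventually_elim (auto intro: F0 simp: p)
  then have "((\<lambda>t. F (x + t *\<^sub>R x0) (y + t *\<^sub>R y0)) \<longlongrightarrow> 0) (at 0)"
    by (rule tendsto_eventually)
  moreover have "((\<lambda>t. F (x + t *\<^sub>R x0) (y + t *\<^sub>R y0)) \<longlongrightarrow> F x y) (at 0)"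
    using cont[of x x0 y y0] by (simp add: isCont_def)
  ultimately show ?thesis by (rule tendsto_unique[OF trivial_limit_at, symmetric])
qed

lemma isCont_dep_form:
  fixes a :: "real ^ 'n" and b :: "real ^ 'm"
  assumes f: "isCont f t" and g: "isCont g t"
  shows "isCont (\<lambda>t. dep_form a b T (f t) (g t)) t"
proof -
  have "isCont (\<lambda>t. T *v g t) t"
    using g by (rule bounded_linear.isCont[OF matrix_vector_mul_bounded_linear])
  then show ?thesis
    unfolding dep_form_def dot_real using f g
    by (intro continuous_diff continuous_add continuous_mult continuous_power continuous_inner
      continuous_const)
qed

section \<open>Extension of form identities from real to complex vectors\<close>

definition of_real_vec :: "real ^ 'n \<Rightarrow> complex ^ 'n"
  where "of_real_vec x = (\<chi> i. of_real (x $ i))"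

definition of_real_mat :: "real ^ 'm ^ 'n \<Rightarrow> complex ^ 'm ^ 'n"
  where "of_real_mat A = (\<chi> i j. of_real (A $ i $ j))"

lemma dot_of_real_vec: "dot (of_real_vec x) (of_real_vec y) = of_real (dot x y)"
  by (simp add: dot_def of_real_vec_def)

lemma of_real_mat_mult_vec: "of_real_mat A *v of_real_vec x = of_real_vec (A *v x)"
  by (simp add: of_real_mat_def of_real_vec_def matrix_vector_mult_def vec_eq_iff)

lemma dep_form_of_real:
  "dep_form (of_real_vec a) (of_real_vec b) (of_real_mat T) (of_real_vec x) (of_real_vec y)
    = of_real (dep_form a b T x y)"
  by (simp add: dep_form_def dot_of_real_vec of_real_mat_mult_vec)

text \<open>Write \<open>z = u + \<i> v\<close> with real \<open>u\<close> and \<open>v\<close>.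
  Vanishing at \<open>u\<close>, \<open>v\<close> and \<open>u + v\<close> kills the symmetrised
  cross term by polarisation, and these are the only terms in the value at \<open>z\<close>.\<close>

lemma quadratic_zero_complex:
  fixes c :: "'n::finite \<Rightarrow> 'n \<Rightarrow> complex"
  assumes real: "\<And>u :: real ^ 'n.
      (\<Sum>i\<in>UNIV. \<Sum>j\<in>UNIV. c i j * of_real (u $ i) * of_real (u $ j)) = 0"
  shows "(\<Sum>i\<in>UNIV. \<Sum>j\<in>UNIV. c i j * z $ i * z $ j) = 0"
proof -
  define B where "B x y = (\<Sum>i\<in>UNIV. \<Sum>j\<in>UNIV. c i j * x $ i * y $ j)" for x y :: "complex ^ 'n"
  define u where "u = (of_real_vec (\<chi> i. Re (z $ i)) :: complex ^ 'n)"
  define v where "v = (of_real_vec (\<chi> i. Im (z $ i)) :: complex ^ 'n)"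
  have B0: "B (of_real_vec w) (of_real_vec w) = 0" for w
    using real[of w] by (simp add: B_def of_real_vec_def)
  have ad: "B (x + x') (y + y') = B x y + B x y' + B x' y + B x' y'" for x x' y y'
    by (simp add: B_def sum.distrib algebra_simps)
  have uu: "B u u = 0" and vv: "B v v = 0" by (simp_all add: u_def v_def B0)
  have "of_real_vec ((\<chi> i. Re (z $ i)) + (\<chi> i. Im (z $ i))) = u + v"
    by (simp add: u_def v_def of_real_vec_def vec_eq_iff)
  then have "B (u + v) (u + v) = 0" by (metis B0)
  then have cross: "B u v + B v u = 0" using uu vv by (simp add: ad)
  have z: "z = u + \<i> *s v"
    by (simp add: u_def v_def of_real_vec_def vec_eq_iff complex_eq_iff)
  have sm: "B x (\<i> *s y) = \<i> * B x y" "B (\<i> *s x) y = \<i> * B x y" for x y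
    by (simp_all add: B_def sum_distrib_left mult_ac)
  have "B z z = B u u + \<i> * (B u v + B v u) - B v v"
    by (simp add: z ad sm algebra_simps)
  then show ?thesis using uu vv cross by (simp add: B_def)
qed

lemma dep_form_swap: "dep_form a b T x y = dep_form b a (transpose T) y x"
  by (simp add: dep_form_def dot_transpose[of x T y] algebra_simps)

text \<open>For fixed \<open>y\<close> the form is displayed as a quadratic form in \<open>x\<close>
  with explicit coefficients, the shape that \<open>quadratic_zero_complex\<close> expects.\<close>

lemma dep_form_coeffs:
  "dep_form a b T x y = (\<Sum>i\<in>UNIV. \<Sum>j\<in>UNIV.
     ((if i = j then dot y y - (dot b y)\<^sup>2 else 0) + (T *v y) $ i * (T *v y) $ j
       - a $ i * a $ j * dot y y) * x $ i * x $ j)"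
proof -
  define k where "k = dot y y - (dot b y)\<^sup>2"
  have 1: "(\<Sum>i\<in>UNIV. \<Sum>j\<in>UNIV. (if i = j then k else 0) * x $ i * x $ j) = k * dot x x"
  proof -
    have "(\<Sum>j\<in>UNIV. (if i = j then k else 0) * x $ i * x $ j)
        = (\<Sum>j\<in>UNIV. if i = j then k * x $ i * x $ j else 0)" for i
      by (rule sum.cong) auto
    then show ?thesis by (simp add: dot_def sum_distrib_left mult_ac)
  qed
  have 2: "(\<Sum>i\<in>UNIV. \<Sum>j\<in>UNIV. w $ i * w $ j * x $ i * x $ j) = (dot w x)\<^sup>2" for w
    by (simp add: dot_def power2_eq_square sum_product mult_ac)
  have 3: "(\<Sum>i\<in>UNIV. \<Sum>j\<in>UNIV. w $ i * w $ j * c * x $ i * x $ j) = (dot w x)\<^sup>2 * c" for w c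
    unfolding 2[symmetric] by (simp add: sum_distrib_left mult_ac)
  have "(\<Sum>i\<in>UNIV. \<Sum>j\<in>UNIV.
     ((if i = j then k else 0) + (T *v y) $ i * (T *v y) $ j
       - a $ i * a $ j * dot y y) * x $ i * x $ j)
    = k * dot x x + (dot (T *v y) x)\<^sup>2 - (dot a x)\<^sup>2 * dot y y"
    by (simp only: distrib_right left_diff_distrib sum.distrib sum_subtractf 1 2 3)
  also have "\<dots> = dep_form a b T x y"
    by (simp add: dep_form_def k_def dot_commute[of "T *v y"] algebra_simps)
  finally show ?thesis unfolding k_def by (rule sym)
qed

lemma dep_form_proportional_left:
  fixes a a' :: "complex ^ 'n" and b b' :: "complex ^ 'm"
  assumes "\<And>x. dep_form a' b' T' (of_real_vec x) y = l * dep_form a b T (of_real_vec x) y"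
  shows "dep_form a' b' T' x y = l * dep_form a b T x y"
proof -
  define c where "c a b T i j = (if i = j then dot y y - (dot b y)\<^sup>2 else 0)
      + (T *v y) $ i * (T *v y) $ j - a $ i * a $ j * dot y y"
    for a :: "complex ^ 'n" and b :: "complex ^ 'm" and T i j
  define e where "e i j = c a' b' T' i j - l * c a b T i j" for i j
  have co: "dep_form a' b' T' x y - l * dep_form a b T x y
      = (\<Sum>i\<in>UNIV. \<Sum>j\<in>UNIV. e i j * x $ i * x $ j)" for x
    unfolding dep_form_coeffs c_def[symmetric] e_def
    by (simp add: algebra_simps sum_subtractf sum_distrib_left)
  have "(\<Sum>i\<in>UNIV. \<Sum>j\<in>UNIV. e i j * x $ i * x $ j) = 0"
  proof (rule quadratic_zero_complex)
    fix u :: "real ^ 'n"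
    show "(\<Sum>i\<in>UNIV. \<Sum>j\<in>UNIV. e i j * of_real (u $ i) * of_real (u $ j)) = 0"
      using co[of "of_real_vec u"] assms[of u] by (simp add: of_real_vec_def)
  qed
  then show ?thesis using co[of x] by simp
qed

text \<open>The variables are complexified one at a time: \<open>dep_form_swap\<close> lets the
  one-sided lemma act first on \<open>y\<close> with \<open>x\<close> real, then on \<open>x\<close>
  with \<open>y\<close> already complex.\<close>

lemma dep_form_proportional_complex:
  assumes "\<And>x y. dep_form a' b' T' x y = l * dep_form a b T x y"
  shows "dep_form (of_real_vec a') (of_real_vec b') (of_real_mat T') x y
    = of_real l * dep_form (of_real_vec a) (of_real_vec b) (of_real_mat T) x y"
proof (rule dep_form_proportional_left)
  fix u
  show "dep_form (of_real_vec a') (of_real_vec b') (of_real_mat T') (of_real_vec u) y =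
    of_real l * dep_form (of_real_vec a) (of_real_vec b) (of_real_mat T) (of_real_vec u) y"
    unfolding dep_form_swap[of _ _ _ "of_real_vec u"]
  proof (rule dep_form_proportional_left)
    fix v
    show "dep_form (of_real_vec b') (of_real_vec a') (transpose (of_real_mat T')) (of_real_vec v) (of_real_vec u) =
      of_real l * dep_form (of_real_vec b) (of_real_vec a) (transpose (of_real_mat T)) (of_real_vec v) (of_real_vec u)"
      unfolding dep_form_swap[symmetric] dep_form_of_real assms by simp
  qed
qed

section \<open>Isotropic vectors and rigidity of the denominator form\<close>

text \<open>The isotropic cone is parametrised by \<open>(1 - s\<^sup>2, \<i> (1 + s\<^sup>2), 2 s)\<close>, which turns linear
  functionals on it into polynomials in \<open>s\<close>.\<close>

lemma isotropic_linear_product: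
  fixes m n :: "complex ^ 3"
  assumes "\<And>x. dot x x = 0 \<Longrightarrow> dot m x * dot n x = 0"
  shows "m = 0 \<or> n = 0"
proof -
  define p where "p m = [:m $ 1 + \<i> * m $ 2, 2 * m $ 3, \<i> * m $ 2 - m $ 1:]" for m :: "complex ^ 3"
  define x where "x s = (vector [1 - s\<^sup>2, \<i> * (1 + s\<^sup>2), 2 * s] :: complex ^ 3)" for s
  have iso: "dot (x s) (x s) = 0" for s
    by (simp add: dot_def sum_3 x_def algebra_simps power2_eq_square)
  have p: "poly (p m) s = dot m (x s)" for m s
    by (simp add: dot_def sum_3 x_def p_def algebra_simps power2_eq_square)
  have "poly (p m * p n) s = 0" for s
    using assms[OF iso] by (simp add: p)
  \<comment> \<open>A complex polynomial vanishing everywhere is zero, and there are no zero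
    divisors. This makes the choice of the vanishing factor uniform over the cone.\<close>
  then have "p m * p n = 0" using poly_all_0_iff_0 by blast
  then have "p m = 0 \<or> p n = 0" by simp
  moreover have "m = 0" if "p m = 0" for m
    using that by (auto simp: p_def vec_eq_iff forall_3 complex_eq_iff)
  ultimately show ?thesis by blast
qed

text \<open>The linear case is used twice. For fixed isotropic \<open>y\<close> it gives
  \<open>M *v y = 0\<close> or \<open>N *v y = 0\<close>; hence the product of a nonzero row of
  \<open>M\<close> and one of \<open>N\<close> would vanish on all isotropic \<open>y\<close>, which
  the linear case excludes.\<close>

lemma isotropic_bilinear_product:
  fixes M N :: "complex ^ 3 ^ 3"
  assumes "\<And>x y. dot x x = 0 \<Longrightarrow> dot y y = 0 \<Longrightarrow> dot x (M *v y) * dot x (N *v y) = 0"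
  shows "M = 0 \<or> N = 0"
proof (rule ccontr)
  assume "\<not> (M = 0 \<or> N = 0)"
  then obtain i j where i: "M $ i \<noteq> 0" and j: "N $ j \<noteq> 0" by (auto simp: vec_eq_iff)
  have row: "(A *v y) $ i = dot (A $ i) y" for A :: "complex ^ 3 ^ 3" and y i
    by (simp add: matrix_vector_mult_def dot_def)
  have "dot (M $ i) y * dot (N $ j) y = 0" if "dot y y = 0" for y
  proof -
    have "M *v y = 0 \<or> N *v y = 0"
      using assms that by (intro isotropic_linear_product) (auto simp: dot_commute)
    then show ?thesis by (metis row mult_eq_0_iff zero_index)
  qed
  from isotropic_linear_product[OF this] i j show False by simp
qed

lemma dep_form_proportional_imp:
  fixes a b a' b' :: "real ^ 3" and T T' :: "real ^ 3 ^ 3"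
  assumes D: "\<And>x y. dep_form a' b' T' x y = l * dep_form a b T x y" and l: "l > 0"
  shows "l = 1" "T' = T \<or> T' = - T" "a' = a \<or> a' = - a" "b' = b \<or> b' = - b"
proof -
  define \<mu> where "\<mu> = sqrt l"
  have \<mu>: "of_real l = (of_real \<mu> :: complex)\<^sup>2"
    using l unfolding \<mu>_def of_real_power[symmetric] by simp
  let ?v = of_real_vec and ?m = of_real_mat
  note DC = dep_form_proportional_complex[OF D]
  \<comment> \<open>On two isotropic vectors only the squared correlation term of
    \<open>dep_form\<close> survives. The resulting equality of squares factors as a difference of
    squares.\<close>
  have "?m T' - ?m (\<mu> *\<^sub>R T) = 0 \<or> ?m T' + ?m (\<mu> *\<^sub>R T) = 0"
  proof (rule isotropic_bilinear_product)
    fix x y :: "complex ^ 3" assume iso: "dot x x = 0" "dot y y = 0"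
    have sc: "?m (\<mu> *\<^sub>R T) *v y = of_real \<mu> *s (?m T *v y)"
      by (simp add: of_real_mat_def matrix_vector_mult_def vec_eq_iff sum_distrib_left mult_ac)
    have "(dot x (?m T' *v y))\<^sup>2 = of_real l * (dot x (?m T *v y))\<^sup>2"
      using DC[of x y] iso by (simp add: dep_form_def)
    then show "dot x ((?m T' - ?m (\<mu> *\<^sub>R T)) *v y) * dot x ((?m T' + ?m (\<mu> *\<^sub>R T)) *v y) = 0"
      by (simp add: matrix_vector_mult_diff_rdistrib matrix_vector_mult_add_rdistrib sc \<mu>
        dot_simps algebra_simps power2_eq_square)
  qed
  then have T: "T' = \<mu> *\<^sub>R T \<or> T' = - (\<mu> *\<^sub>R T)"
    by (auto simp: of_real_mat_def vec_eq_iff eq_neg_iff_add_eq_0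
      simp flip: of_real_mult of_real_add of_real_diff)
  \<comment> \<open>With \<open>T'\<close> known up to sign, the correlation terms match for all
    complex \<open>x\<close> and \<open>y\<close> and cancel from the identity below.\<close>
  have TT: "(dot x (?m T' *v y))\<^sup>2 = of_real l * (dot x (?m T *v y))\<^sup>2" for x y
  proof -
    have "?m (\<mu> *\<^sub>R T) *v y = of_real \<mu> *s (?m T *v y)"
      "?m (- (\<mu> *\<^sub>R T)) *v y = - (of_real \<mu> *s (?m T *v y))"
      by (simp_all add: of_real_mat_def matrix_vector_mult_def vec_eq_iff sum_distrib_left
        sum_negf mult_ac)
    then show ?thesis using T \<mu> by (auto simp: dot_simps power_mult_distrib)
  qed
  have iso1: "c' = \<mu> *\<^sub>R c \<or> c' = - (\<mu> *\<^sub>R c)"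
    if "\<And>x. dot x x = 0 \<Longrightarrow> (dot (?v c') x)\<^sup>2 = of_real l * (dot (?v c) x)\<^sup>2" for c c' :: "real ^ 3"
  proof -
    have "?v c' - of_real \<mu> *s ?v c = 0 \<or> ?v c' + of_real \<mu> *s ?v c = 0"
    proof (rule isotropic_linear_product)
      fix x :: "complex ^ 3" assume "dot x x = 0"
      from that[OF this] show "dot (?v c' - of_real \<mu> *s ?v c) x * dot (?v c' + of_real \<mu> *s ?v c) x = 0"
        by (simp add: dot_simps algebra_simps power2_eq_square \<mu>)
    qed
    then show ?thesis
      by (auto simp: of_real_vec_def vec_eq_iff eq_neg_iff_add_eq_0
      simp flip: of_real_mult of_real_add of_real_diff)
  qed
  \<comment> \<open>Pairing an isotropic vector with this non-isotropic \<open>e\<close> leaves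
    exactly one marginal term besides the correlation term, which isolates \<open>a\<close> or
    \<open>b\<close>.\<close>
  obtain e :: "complex ^ 3" where e: "dot e e = 1"
    using that[of "axis 1 1"] by (simp add: dot_axis)
  have a: "a' = \<mu> *\<^sub>R a \<or> a' = - (\<mu> *\<^sub>R a)"
  proof (rule iso1)
    fix x :: "complex ^ 3" assume "dot x x = 0"
    then show "(dot (?v a') x)\<^sup>2 = of_real l * (dot (?v a) x)\<^sup>2"
      using DC[of x e] e TT[of x e] by (simp add: dep_form_def algebra_simps)
  qed
  have b: "b' = \<mu> *\<^sub>R b \<or> b' = - (\<mu> *\<^sub>R b)"
  proof (rule iso1)
    fix y :: "complex ^ 3" assume "dot y y = 0"
    then show "(dot (?v b') y)\<^sup>2 = of_real l * (dot (?v b) y)\<^sup>2"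
      using DC[of e y] e TT[of e y] by (simp add: dep_form_def algebra_simps)
  qed
  have vv: "(dot (?v c') x)\<^sup>2 = of_real l * (dot (?v c) x)\<^sup>2"
    if "c' = \<mu> *\<^sub>R c \<or> c' = - (\<mu> *\<^sub>R c)" for c c' :: "real ^ 3" and x
  proof -
    have "?v (\<mu> *\<^sub>R c) = of_real \<mu> *s ?v c" "?v (- (\<mu> *\<^sub>R c)) = - (of_real \<mu> *s ?v c)"
      by (simp_all add: of_real_vec_def vec_eq_iff)
    then show ?thesis using that \<mu> by (auto simp: dot_simps power_mult_distrib)
  qed
  \<comment> \<open>At \<open>x = y = e\<close> every term except the constant
    \<open>dot e e * dot e e = 1\<close> already scales by \<open>l\<close>, so the constants must
    agree: \<open>1 = l\<close>.\<close>
  have "of_real l = (1 :: complex)"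
    using DC[of e e] e TT[of e e] vv[OF a, of e] vv[OF b, of e]
    by (simp add: dep_form_def algebra_simps)
  then show "l = 1" by simp
  then have "\<mu> = 1" by (simp add: \<mu>_def)
  then show "T' = T \<or> T' = - T" "a' = a \<or> a' = - a" "b' = b \<or> b' = - b" using T a b by simp_all
qed

section \<open>Block positivity and strict positivity of the denominator\<close>

text \<open>This is nonnegativity of \<open>4 p\<^sub>+\<^sub>+(x, y)\<close>; the other three outcomes arise by replacing \<open>x\<close>
  by \<open>- x\<close> or \<open>y\<close> by \<open>- y\<close>.\<close>

definition block_positive :: "real ^ 'n \<Rightarrow> real ^ 'm \<Rightarrow> real ^ 'm ^ 'n \<Rightarrow> bool"
  where "block_positive a b T \<longleftrightarrow>
    (\<forall>x\<in>sphere 0 1. \<forall>y\<in>sphere 0 1. 0 \<le> 1 + dot a x + dot b y + dot x (T *v y))"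

lemma block_positive_transpose:
  fixes a :: "real ^ 'n" and b :: "real ^ 'm"
  assumes bp: "block_positive a b T"
  shows "block_positive b a (transpose T)"
  unfolding block_positive_def
proof (intro ballI)
  fix y :: "real ^ 'm" and x :: "real ^ 'n" assume "y \<in> sphere 0 1" "x \<in> sphere 0 1"
  then have "0 \<le> 1 + dot a x + dot b y + dot x (T *v y)"
    using bp unfolding block_positive_def by blast
  also have "dot x (T *v y) = dot y (transpose T *v x)" by (rule dot_transpose)
  finally show "0 \<le> 1 + dot b y + dot a x + dot y (transpose T *v x)" by linarith
qed

text \<open>The minimum of \<open>k + m \<bullet> z\<close> over the unit sphere is \<open>k - \<parallel>m\<parallel>\<close>, so this is the equality
  case of the Cauchy--Schwarz inequality.\<close>

lemma affine_nonneg_sphere_zero: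
  fixes m x :: "real ^ 'n"
  assumes pos: "\<And>z. norm z = 1 \<Longrightarrow> 0 \<le> k + dot m z" and x: "norm x = 1" "k + dot m x = 0"
  shows "m = - (k *\<^sub>R x)"
proof -
  have "norm m \<le> k"
  proof (cases "m = 0")
    case True
    then show ?thesis using x by simp
  next
    case False
    then have "0 \<le> k + dot m (- (m /\<^sub>R norm m))" by (intro pos) simp
    also have "dot m (- (m /\<^sub>R norm m)) = - norm m"
      using False by (simp add: dot_real dot_square_norm power2_eq_square)
    finally show ?thesis by simp
  qed
  then have mk: "(norm m)\<^sup>2 \<le> k\<^sup>2" by (intro power_mono) auto
  \<comment> \<open>By the hypothesis at \<open>x\<close> this square equals
    \<open>(norm m)\<^sup>2 - k\<^sup>2\<close>, which the bound just obtained makes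
    nonpositive.\<close>
  have "(norm (m + k *\<^sub>R x))\<^sup>2 = (norm m)\<^sup>2 + 2 * k * dot m x + k\<^sup>2"
    using x by (simp add: power2_norm_eq_inner inner_simps dot_real inner_commute)
      (simp add: flip: power2_norm_eq_inner add: power2_eq_square algebra_simps)
  also have "dot m x = - k" using x(2) by simp
  also have "(norm m)\<^sup>2 + 2 * k * - k + k\<^sup>2 \<le> 0" using mk by (simp add: power2_eq_square)
  finally show ?thesis by (simp add: add_eq_0_iff)
qed

text \<open>Two zero entries in one row of the table force \<open>dot a x = -1\<close>: the first
  party never obtains that outcome along \<open>x\<close>. For each unit \<open>z\<close>, the
  equality case at \<open>z\<close> and at \<open>-z\<close> then gives \<open>a = - x\<close> and
  \<open>T *v z = dot b z *\<^sub>R a\<close>, so no covariance remains.\<close>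

lemma block_positive_zero_pair:
  assumes bp: "block_positive a b T" and x: "norm x = 1" and y0: "norm y0 = 1"
    and z1: "1 + dot a x + dot b y0 + dot x (T *v y0) = 0"
    and z2: "1 + dot a x - dot b y0 - dot x (T *v y0) = 0"
  shows "cov_form a b T w z = 0"
proof -
  have ax: "1 + dot a x = 0" using z1 z2 by linarith
  have TT: "T *v z = dot b z *\<^sub>R a" if z: "norm z = 1" for z
  proof -
    \<comment> \<open>The entries for \<open>z\<close> and \<open>-z\<close> are nonnegative and add
      up to \<open>2 * (1 + dot a x) = 0\<close>, so both vanish.\<close>
    have zz: "dot b z + dot x (T *v z) = 0"
    proof -
      have "0 \<le> 1 + dot a x + dot b z + dot x (T *v z)"
        "0 \<le> 1 + dot a x + dot b (- z) + dot x (T *v (- z))"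
        using bp x z unfolding block_positive_def by (metis mem_sphere_0 norm_minus_cancel)+
      then show ?thesis using ax by (simp add: dot_simps mv_minus)
    qed
    have "a + T *v z = - ((1 + dot b z) *\<^sub>R x)"
    proof (rule affine_nonneg_sphere_zero)
      fix u :: "real ^ 'a" assume "norm u = 1"
      then have "0 \<le> 1 + dot a u + dot b z + dot u (T *v z)"
        using bp z unfolding block_positive_def by simp
      then show "0 \<le> 1 + dot b z + dot (a + T *v z) u"
        by (simp add: dot_simps dot_commute[of u])
    qed (use x ax zz in \<open>simp_all add: dot_simps dot_commute[of _ x]\<close>)
    moreover have "a - T *v z = - ((1 - dot b z) *\<^sub>R x)"
    proof (rule affine_nonneg_sphere_zero)
      fix u :: "real ^ 'a" assume "norm u = 1"
      then have "0 \<le> 1 + dot a u + dot b (- z) + dot u (T *v (- z))"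
        using bp z unfolding block_positive_def by simp
      then show "0 \<le> 1 - dot b z + dot (a - T *v z) u"
        by (simp add: dot_simps dot_commute[of u] mv_minus)
    qed (use x ax zz in \<open>simp_all add: dot_simps dot_commute[of _ x]\<close>)
    ultimately have "a $ i + (T *v z) $ i = - (x $ i) - dot b z * x $ i"
      "a $ i - (T *v z) $ i = - (x $ i) + dot b z * x $ i" for i
      by (simp_all add: vec_eq_iff algebra_simps)
    then have "a $ i = - (x $ i) \<and> (T *v z) $ i = - (dot b z * x $ i)" for i
      by (smt (verit))
    then show ?thesis by (simp add: vec_eq_iff)
  qed
  have "cov_form a b T w z = 0" if "norm z = 1" for z
    using TT[OF that] by (simp add: cov_form_def dot_simps dot_commute[of a] flip: scalar_mult_eq_scaleR)
  then have "cov_form a b T w (z /\<^sub>R norm z) = 0" if "z \<noteq> 0" using that by simp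
  then have "z \<noteq> 0 \<Longrightarrow> cov_form a b T w z = 0"
    by (simp add: cov_form_smult_right flip: scalar_mult_eq_scaleR)
  then show ?thesis by (cases "z = 0") (simp_all add: cov_form_def)
qed

lemma cov_form_swap: "cov_form a b T x y = cov_form b a (transpose T) y x"
  by (simp add: cov_form_def dot_transpose[of x T y])

text \<open>Twice the denominator is the sum of the two diagonal products of the table, up to
  scaling. If both products vanished, two zero entries would share a row or a column, and
  \<open>block_positive_zero_pair\<close> or its transpose would kill the covariance.\<close>

lemma block_positive_dep_form_pos:
  assumes bp: "block_positive a b T" and nz: "cov_form a b T w z \<noteq> 0"
    and xy: "norm x = 1" "norm y = 1"
  shows "0 < dep_form a b T x y"
proof -
  let ?A = "dot a x" and ?B = "dot b y" and ?E = "dot x (T *v y)"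
  have p: "0 \<le> 1 + ?A + ?B + ?E" "0 \<le> 1 + ?A - ?B - ?E" "0 \<le> 1 - ?A + ?B - ?E" "0 \<le> 1 - ?A - ?B + ?E"
  proof -
    have "0 \<le> 1 + dot a u + dot b v + dot u (T *v v)" if "u \<in> {x, -x}" "v \<in> {y, -y}" for u v
      using that bp xy unfolding block_positive_def by auto
    from this[of x y] this[of x "-y"] this[of "-x" y] this[of "-x" "-y"]
    show "0 \<le> 1 + ?A + ?B + ?E" "0 \<le> 1 + ?A - ?B - ?E" "0 \<le> 1 - ?A + ?B - ?E" "0 \<le> 1 - ?A - ?B + ?E"
      by (simp_all add: dot_simps mv_minus)
  qed
  have dxy: "dot x x = 1" "dot y y = 1" using xy by (simp_all add: dot_real dot_square_norm)
  have eq: "2 * dep_form a b T x y = (1 + ?A + ?B + ?E) * (1 - ?A - ?B + ?E) + (1 + ?A - ?B - ?E) * (1 - ?A + ?B - ?E)"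
    using dxy by (simp add: dep_form_def power2_eq_square algebra_simps)
  have 1: "\<not> (1 + ?A + ?B + ?E = 0 \<and> 1 + ?A - ?B - ?E = 0)"
    using block_positive_zero_pair[OF bp xy] nz by auto
  have 2: "\<not> (1 - ?A - ?B + ?E = 0 \<and> 1 - ?A + ?B - ?E = 0)"
    using block_positive_zero_pair[OF bp, of "-x" y] xy nz by (auto simp: dot_simps)
  note bpt = block_positive_transpose[OF bp] and nzt = nz[unfolded cov_form_swap[of _ _ _ w]]
  have 3: "\<not> (1 + ?A + ?B + ?E = 0 \<and> 1 - ?A + ?B - ?E = 0)"
    using block_positive_zero_pair[OF bpt xy(2,1)] nzt
    by (auto simp: dot_transpose[of x T y] algebra_simps)
  have 4: "\<not> (1 - ?A - ?B + ?E = 0 \<and> 1 + ?A - ?B - ?E = 0)"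
    using block_positive_zero_pair[OF bpt, of "-y" x] xy nzt
    by (auto simp: dot_transpose[of x T y] dot_simps algebra_simps)
  have "(1 + ?A + ?B + ?E) * (1 - ?A - ?B + ?E) \<noteq> 0 \<or> (1 + ?A - ?B - ?E) * (1 - ?A + ?B - ?E) \<noteq> 0"
    using 1 2 3 4 by auto
  moreover have "0 \<le> (1 + ?A + ?B + ?E) * (1 - ?A - ?B + ?E)" "0 \<le> (1 + ?A - ?B - ?E) * (1 - ?A + ?B - ?E)"
    using p by simp_all
  ultimately show ?thesis using eq by linarith
qed

section \<open>Recovery of the Bloch data up to a common sign of the marginals\<close>

lemma dependence_ratio_determines:
  fixes a b a' b' :: "real ^ 3" and T T' :: "real ^ 3 ^ 3"
  assumes bp: "block_positive a b T" and bp': "block_positive a' b' T'"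
    and nz: "cov_form a b T x0 y0 \<noteq> 0" and nz': "cov_form a' b' T' x0' y0' \<noteq> 0"
    and Q: "\<And>x y. norm x = 1 \<Longrightarrow> norm y = 1 \<Longrightarrow>
      cov_form a b T x y / dep_form a b T x y = cov_form a' b' T' x y / dep_form a' b' T' x y"
  shows "T' = T \<and> (a' = a \<and> b' = b \<or> a' = - a \<and> b' = - b)"
proof -
  note pos = block_positive_dep_form_pos[OF bp nz] and pos' = block_positive_dep_form_pos[OF bp' nz']
  have unit: "\<exists>c u. norm u = 1 \<and> c > 0 \<and> x = c *s u" if "x \<noteq> 0" for x :: "real ^ 3"
    using that by (intro exI[of _ "norm x"] exI[of _ "x /\<^sub>R norm x"]) (auto simp: scalar_mult_eq_scaleR)
  \<comment> \<open>After clearing denominators both sides are homogeneous of degree three in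
    \<open>x\<close> and in \<open>y\<close>, so the identity passes from unit vectors to all
    vectors.\<close>
  have GD: "cov_form a b T x y * dep_form a' b' T' x y = cov_form a' b' T' x y * dep_form a b T x y" for x y
  proof (cases "x = 0 \<or> y = 0")
    case True
    then show ?thesis by (auto simp: cov_form_def)
  next
    case False
    then obtain c u d v where u: "norm u = 1" "x = c *s u" and v: "norm v = 1" "y = d *s v"
      using unit[of x] unit[of y] by blast
    have "cov_form a b T u v * dep_form a' b' T' u v = cov_form a' b' T' u v * dep_form a b T u v"
      using Q[OF u(1) v(1)] pos[OF u(1) v(1)] pos'[OF u(1) v(1)] by (simp add: field_simps)
    then show ?thesis by (simp add: u v cov_form_scale dep_form_scale)
  qed
  have posn: "0 < dep_form a b T x y" "0 < dep_form a' b' T' x y" if n0: "x \<noteq> 0" "y \<noteq> 0" for x y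
  proof -
    obtain c u where u: "norm u = 1" "x = c *s u" "c > 0" using unit[OF n0(1)] by blast
    obtain d v where v: "norm v = 1" "y = d *s v" "d > 0" using unit[OF n0(2)] by blast
    show "0 < dep_form a b T x y" "0 < dep_form a' b' T' x y"
      using pos[OF u(1) v(1)] pos'[OF u(1) v(1)] u(3) v(3)
      unfolding u(2) v(2) dep_form_scale by simp_all
  qed
  have "\<exists>l. \<forall>x y. cov_form a' b' T' x y = l * cov_form a b T x y"
  proof (rule bilinear_proportional[OF bilinear_cov_form bilinear_cov_form])
    fix x y assume 0: "cov_form a b T x y = 0"
    show "cov_form a' b' T' x y = 0"
    proof (cases "x = 0 \<or> y = 0")
      case True
      then show ?thesis by (auto simp: cov_form_def)
    next
      case False
      then show ?thesis using GD[of x y] 0 posn[of x y] by simp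
    qed
  qed
  then obtain l where l: "\<And>x y. cov_form a' b' T' x y = l * cov_form a b T x y" by blast
  \<comment> \<open>Where the covariance is nonzero it cancels from \<open>GD\<close>, so the
    denominators are proportional with the same factor \<open>l\<close>. Density extends this to all
    pairs in \<open>DD\<close>.\<close>
  have Dl: "dep_form a' b' T' x y = l * dep_form a b T x y" if "cov_form a b T x y \<noteq> 0" for x y
    using GD[of x y] that by (simp add: l)
  have "x0 \<noteq> 0" "y0 \<noteq> 0" using nz by (auto simp: cov_form_def)
  from Dl[OF nz] posn[OF this] have lpos: "l > 0" by (simp add: zero_less_mult_iff)
  have DD: "dep_form a' b' T' x y - l * dep_form a b T x y = 0" for x y
  proof (rule bilinear_nonzero_dense[OF bilinear_cov_form nz,
      where F = "\<lambda>x y. dep_form a' b' T' x y - l * dep_form a b T x y"])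
    show "isCont (\<lambda>t. dep_form a' b' T' (x + t *\<^sub>R x') (y + t *\<^sub>R y')
        - l * dep_form a b T (x + t *\<^sub>R x') (y + t *\<^sub>R y')) 0" for x y x' y'
      by (intro continuous_diff continuous_mult continuous_const isCont_dep_form continuous_add
        continuous_scaleR continuous_ident)
  qed (simp add: Dl)
  then have "dep_form a' b' T' x y = l * dep_form a b T x y" for x y
    by (metis eq_iff_diff_eq_0)
  note R = dep_form_proportional_imp[OF this lpos]
  have CC: "cov_form a' b' T' x y = cov_form a b T x y" for x y using l R(1) by simp
  have key: "dot x (T' *v y) - dot a' x * dot b' y = dot x (T *v y) - dot a x * dot b y" for x y
    using CC[of x y] by (simp add: cov_form_def)
  \<comment> \<open>Suppose \<open>T' = - T\<close>, and let \<open>e\<close> be the sign relating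
    the products of marginals. Equality of covariances forces \<open>T = 0\<close> when
    \<open>e = 1\<close>, and zero covariance when \<open>e = - 1\<close>.\<close>
  have TT: "T' = T"
  proof (rule ccontr)
    assume "T' \<noteq> T"
    then have T': "T' = - T" using R(2) by simp
    have "T \<noteq> 0" using \<open>T' \<noteq> T\<close> T' by auto
    have m: "- T *v y = - (T *v y)" for y
      by (simp add: matrix_vector_mult_def vec_eq_iff sum_negf)
    obtain e where e: "e = 1 \<or> e = - 1" and ab: "\<And>x y. dot a' x * dot b' y = e * (dot a x * dot b y)"
    proof -
      have "\<exists>e. (e = 1 \<or> e = - 1) \<and> (\<forall>x y. dot a' x * dot b' y = e * (dot a x * dot b y))"
        using R(3,4) by (auto simp: dot_simps intro: exI[of _ 1] exI[of _ "-1"])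
      then show ?thesis using that by blast
    qed
    have k: "2 * dot x (T *v y) = (1 - e) * (dot a x * dot b y)" for x y
      using key[of x y] by (simp add: T' m dot_simps ab algebra_simps)
    from e show False
    proof
      assume "e = 1"
      then have z: "dot x (T *v y) = 0" for x y using k[of x y] by simp
      have "(T *v y) $ i = 0" for y i using z[of "axis i 1" y] by (simp add: dot_axis)
      then have "T = 0" by (metis matrix_vector_mult_0 matrix_eq vec_eq_iff zero_index)
      then show False using \<open>T \<noteq> 0\<close> by simp
    next
      assume "e = - 1"
      then have "cov_form a b T x0 y0 = 0" using k[of x0 y0] by (simp add: cov_form_def)
      then show False using nz by simp
    qed
  qed
  have prod: "dot a' x * dot b' y = dot a x * dot b y" for x y
    using key[of x y] TT by simp
  have ij: "a' $ i * b' $ j = a $ i * b $ j" for i j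
    using prod[of "axis i 1" "axis j 1"] by (simp add: dot_commute[of _ "axis _ _"] dot_axis)
  show ?thesis
  \<comment> \<open>If only one marginal changes sign, \<open>ij\<close> makes all products
    \<open>a $ i * b $ j\<close> vanish. Then \<open>a\<close> or \<open>b\<close> is zero, and its
    sign can be chosen to fit a claimed alternative.\<close>
  proof (cases "a' = - a \<and> b' = b \<or> a' = a \<and> b' = - b")
    case True
    then have "a $ i = 0 \<or> b $ j = 0" for i j using ij[of i j] by auto
    then have "a = 0 \<or> b = 0" by (metis vec_eq_iff zero_index)
    then show ?thesis using True TT by auto
  next
    case False
    then show ?thesis using R(3,4) TT by blast
  qed
qed

section \<open>Positive semidefinite and Kronecker product matrices\<close>

lemma matrix_mult_scaleR: "A ** (c *\<^sub>R B) = c *\<^sub>R (A ** (B :: complex ^ 'n ^ 'm))"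
  and scaleR_matrix_vector_mult: "(c *\<^sub>R D) *v v = c *\<^sub>R ((D :: complex ^ 'n ^ 'm) *v v)"
  and trace_scaleR: "trace (c *\<^sub>R (E :: complex ^ 'm ^ 'm)) = c *\<^sub>R trace E"
  by (simp_all add: matrix_matrix_mult_def matrix_vector_mult_def trace_def vec_eq_iff scaleR_sum_right)

lemma kron_add_left: "(A + A') \<otimes>\<^sub>m B = A \<otimes>\<^sub>m B + A' \<otimes>\<^sub>m B"
  and kron_add_right: "A \<otimes>\<^sub>m (B + B') = A \<otimes>\<^sub>m B + A \<otimes>\<^sub>m B'"
  and kron_scaleR_left: "(c *\<^sub>R A) \<otimes>\<^sub>m B = c *\<^sub>R (A \<otimes>\<^sub>m B)"
  and kron_scaleR_right: "A \<otimes>\<^sub>m (c *\<^sub>R B) = c *\<^sub>R (A \<otimes>\<^sub>m B)"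
  by (simp_all add: kron_def vec_eq_iff algebra_simps)

lemma sum_UNIV_pair: "(\<Sum>p\<in>UNIV. f p) = (\<Sum>i\<in>UNIV. \<Sum>j\<in>UNIV. f (i, j))"
  by (simp add: sum.cartesian_product)

lemma sum_pair_product:
  fixes f :: "'i::finite \<Rightarrow> 'a::comm_semiring_1" and g :: "'j::finite \<Rightarrow> 'a"
  shows "(\<Sum>p\<in>UNIV. f (fst p) * g (snd p)) = sum f UNIV * sum g UNIV"
  by (simp add: sum_UNIV_pair sum_product)

lemma kron_mult: "(A \<otimes>\<^sub>m B) ** (C \<otimes>\<^sub>m D) = (A ** C) \<otimes>\<^sub>m (B ** D)"
proof -
  have "(\<Sum>k\<in>UNIV. (A \<otimes>\<^sub>m B) $ i $ k * (C \<otimes>\<^sub>m D) $ k $ j)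
      = (\<Sum>k\<in>UNIV. (A $ fst i $ fst k * C $ fst k $ fst j) * (B $ snd i $ snd k * D $ snd k $ snd j))" for i j
    by (simp add: kron_def mult_ac)
  then show ?thesis
    by (simp add: sum_pair_product[of "\<lambda>k. A $ _ $ k * C $ k $ _" "\<lambda>k. B $ _ $ k * D $ k $ _"]
        matrix_matrix_mult_def vec_eq_iff kron_def[of "\<chi> i j. _ i j"])
qed

lemma trace_kron: "trace (A \<otimes>\<^sub>m B) = trace A * trace B"
  by (simp add: trace_def kron_def sum_pair_product[of "\<lambda>i. A $ i $ i" "\<lambda>i. B $ i $ i"])

lemma kron_mat_1: "mat 1 \<otimes>\<^sub>m mat 1 = mat 1"
  by (auto simp: kron_def mat_def vec_eq_iff prod_eq_iff)

section \<open>Hermitian and positive semidefinite matrices\<close>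

definition hermitian :: "complex ^ 'n ^ 'n \<Rightarrow> bool"
  where "hermitian A \<longleftrightarrow> (\<forall>i j. A $ i $ j = cnj (A $ j $ i))"

definition sesq :: "complex ^ 'n ^ 'n \<Rightarrow> complex ^ 'n \<Rightarrow> complex ^ 'n \<Rightarrow> complex"
  where "sesq A u v = (\<Sum>i\<in>UNIV. cnj (u $ i) * (A *v v) $ i)"

lemma pos_semidef_sesq: "pos_semidef A \<longleftrightarrow> (\<forall>v. sesq A v v \<in> \<real> \<and> 0 \<le> Re (sesq A v v))"
  by (simp add: pos_semidef_def sesq_def)

lemma sesq_axis: "sesq A (axis i 1) (axis j 1) = A $ i $ j"
proof -
  have "sesq A (axis i 1) (axis j 1) = (\<Sum>k\<in>UNIV. if k = i then A $ k $ j else 0)"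
    unfolding sesq_def matrix_mult_axis by (rule sum.cong) (auto simp: axis_def)
  then show ?thesis by simp
qed

lemma sesq_add: "sesq A (u + u') (v + v') = sesq A u v + sesq A u v' + sesq A u' v + sesq A u' v'"
  by (simp add: sesq_def matrix_vector_right_distrib sum.distrib algebra_simps)

lemma sesq_smult_right: "sesq A u (c *s v) = c * sesq A u v"
  and sesq_smult_left: "sesq A (c *s u) v = cnj c * sesq A u v"
  by (simp_all add: sesq_def mv_smult sum_distrib_left mult_ac)

text \<open>Polarisation: reality of the quadratic form makes \<open>sesq A u v + sesq A v u\<close>
  real. Testing this on basis vectors, once with a factor \<open>\<i>\<close>, compares the
  imaginary and the real parts of opposite entries.\<close>

lemma pos_semidef_hermitian:
  assumes "pos_semidef A"
  shows "hermitian A"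
  unfolding hermitian_def
proof (intro allI)
  fix i j
  have re: "sesq A v v \<in> \<real>" for v using assms by (simp add: pos_semidef_sesq)
  have cross: "sesq A u v + sesq A v u \<in> \<real>" for u v
  proof -
    have "sesq A u v + sesq A v u = sesq A (u + v) (u + v) - sesq A u u - sesq A v v"
      by (simp add: sesq_add)
    then show ?thesis using re by simp
  qed
  have "A $ i $ j + A $ j $ i \<in> \<real>"
    using cross[of "axis i 1" "axis j 1"] by (simp add: sesq_axis)
  moreover have "\<i> * A $ i $ j - \<i> * A $ j $ i \<in> \<real>"
    using cross[of "axis i 1" "\<i> *s axis j 1"]
    by (simp add: sesq_axis sesq_smult_left sesq_smult_right)
  ultimately show "A $ i $ j = cnj (A $ j $ i)"
    by (simp add: complex_is_Real_iff complex_eq_iff)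
qed

lemma hermitian_adjoint:
  assumes "hermitian M"
  shows "(\<Sum>i\<in>UNIV. cnj (u $ i) * (M *v v) $ i) = (\<Sum>i\<in>UNIV. cnj ((M *v u) $ i) * v $ i)"
proof -
  have h: "cnj (M $ i $ j) = M $ j $ i" for i j using assms by (metis hermitian_def)
  have "(\<Sum>i\<in>UNIV. cnj (u $ i) * (M *v v) $ i) = (\<Sum>i\<in>UNIV. \<Sum>j\<in>UNIV. cnj (u $ i) * M $ i $ j * v $ j)"
    by (simp add: matrix_vector_mult_def sum_distrib_left mult_ac)
  also have "\<dots> = (\<Sum>j\<in>UNIV. \<Sum>i\<in>UNIV. cnj (u $ i) * M $ i $ j * v $ j)" by (rule sum.swap)
  also have "\<dots> = (\<Sum>i\<in>UNIV. cnj ((M *v u) $ i) * v $ i)"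
    by (simp add: matrix_vector_mult_def sum_distrib_left sum_distrib_right h mult_ac)
  finally show ?thesis .
qed

lemma pos_semidef_congruence:
  assumes "pos_semidef A" "hermitian M"
  shows "pos_semidef (M ** A ** M)"
proof -
  have "sesq (M ** A ** M) v v = sesq A (M *v v) (M *v v)" for v
    unfolding sesq_def by (simp flip: matrix_vector_mul_assoc add: hermitian_adjoint[OF assms(2)])
  then show ?thesis using assms(1) by (simp add: pos_semidef_sesq)
qed

lemma pos_semidef_trace_nonneg:
  assumes "pos_semidef A"
  shows "0 \<le> Re (trace A)"
proof -
  have "0 \<le> Re (A $ i $ i)" for i
    using assms by (metis pos_semidef_sesq sesq_axis)
  then show ?thesis by (simp add: trace_def sum_nonneg)
qed

text \<open>Idempotence and cyclicity turn the trace into that of \<open>M ** A ** M\<close>, a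
  positive semidefinite matrix. This is why Born probabilities are nonnegative.\<close>

lemma trace_mult_projection_nonneg:
  assumes "pos_semidef A" "hermitian M" "M ** M = M"
  shows "0 \<le> Re (trace (A ** M))"
proof -
  have "trace (A ** M) = trace (A ** M ** M)" by (simp add: assms(3) flip: matrix_mul_assoc)
  also have "\<dots> = trace (M ** A ** M)" by (simp add: trace_mul_sym[of "A ** M"] matrix_mul_assoc)
  finally show ?thesis using pos_semidef_trace_nonneg[OF pos_semidef_congruence[OF assms(1,2)]] by simp
qed

lemma pos_semidef_add: "pos_semidef A \<Longrightarrow> pos_semidef B \<Longrightarrow> pos_semidef (A + B)"
proof -
  have "sesq (A + B) v v = sesq A v v + sesq B v v" for v
    by (simp add: sesq_def matrix_vector_mult_add_rdistrib algebra_simps sum.distrib)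
  then show "pos_semidef A \<Longrightarrow> pos_semidef B \<Longrightarrow> pos_semidef (A + B)"
    by (auto simp: pos_semidef_sesq)
qed

lemma pos_semidef_scaleR: "pos_semidef A \<Longrightarrow> 0 \<le> c \<Longrightarrow> pos_semidef (c *\<^sub>R A)"
proof -
  have "sesq (c *\<^sub>R A) v v = of_real c * sesq A v v" for v
    unfolding sesq_def scaleR_matrix_vector_mult
    by (simp add: sum_distrib_left scaleR_conv_of_real[where 'a=complex] mult_ac)
  then show "pos_semidef A \<Longrightarrow> 0 \<le> c \<Longrightarrow> pos_semidef (c *\<^sub>R A)"
    by (auto simp: pos_semidef_sesq)
qed

lemma pos_semidef_mat_1: "pos_semidef (mat 1 :: complex ^ 'n ^ 'n)"
proof -
  have "sesq (mat 1) v v = of_real (\<Sum>i\<in>UNIV. (norm (v $ i))\<^sup>2)" for v :: "complex ^ 'n"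
    by (simp add: sesq_def complex_norm_square mult.commute del: of_real_power)
  then show ?thesis by (simp add: pos_semidef_sesq sum_nonneg del: of_real_sum of_real_power)
qed

lemma pos_semidef_projection: "hermitian M \<Longrightarrow> M ** M = M \<Longrightarrow> pos_semidef M"
  using pos_semidef_congruence[OF pos_semidef_mat_1, of M] by simp

lemma pos_semidef_conj_matrix: "pos_semidef A \<Longrightarrow> pos_semidef (conj_matrix A)"
proof -
  have "sesq (conj_matrix A) v v = cnj (sesq A (\<chi> i. cnj (v $ i)) (\<chi> i. cnj (v $ i)))" for v
    by (simp add: sesq_def conj_matrix_def matrix_vector_mult_def)
  then show "pos_semidef A \<Longrightarrow> pos_semidef (conj_matrix A)"
    by (auto simp: pos_semidef_sesq Reals_cnj_iff)
qed

lemma conj_matrix_mult: "conj_matrix (A ** B) = conj_matrix A ** conj_matrix B"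
  by (simp add: conj_matrix_def matrix_matrix_mult_def vec_eq_iff)

lemma conj_matrix_conj [simp]: "conj_matrix (conj_matrix A) = A"
  by (simp add: conj_matrix_def vec_eq_iff)

lemma conj_kron: "conj_matrix (A \<otimes>\<^sub>m B) = conj_matrix A \<otimes>\<^sub>m conj_matrix B"
  by (simp add: conj_matrix_def kron_def vec_eq_iff)

lemma trace_conj: "trace (conj_matrix A) = cnj (trace A)"
  by (simp add: conj_matrix_def trace_def)

text \<open>Conjugation reverses the order of the factors, and cyclicity restores it.\<close>

lemma hermitian_trace_mult_real:
  assumes "hermitian A" "hermitian B"
  shows "trace (A ** B) \<in> \<real>"
proof -
  have h: "cnj (A $ i $ j) = A $ j $ i" "cnj (B $ i $ j) = B $ j $ i" for i j
    using assms by (metis hermitian_def)+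
  have "cnj (trace (A ** B)) = (\<Sum>i\<in>UNIV. \<Sum>j\<in>UNIV. B $ i $ j * A $ j $ i)"
    by (simp add: trace_def matrix_matrix_mult_def h mult.commute)
  also have "\<dots> = trace (B ** A)" by (simp add: trace_def matrix_matrix_mult_def)
  finally show ?thesis by (simp add: Reals_cnj_iff trace_mul_sym[of A])
qed

lemma hermitian_kron:
  assumes "hermitian A" "hermitian B"
  shows "hermitian (A \<otimes>\<^sub>m B)"
proof -
  have "cnj (A $ i $ j) = A $ j $ i" "cnj (B $ i $ j) = B $ j $ i" for i j
    using assms by (metis hermitian_def)+
  then show ?thesis by (simp add: hermitian_def kron_def)
qed

section \<open>Bloch coordinates\<close>

definition pauli :: "3 \<Rightarrow> qubit_op"
  where "pauli i = (if i = 1 then pauli_x else if i = 2 then pauli_y else pauli_z)"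

lemma pauli_simps [simp]: "pauli 1 = pauli_x" "pauli 2 = pauli_y" "pauli 3 = pauli_z"
  by (simp_all add: pauli_def)

lemmas pauli_defs = pauli_x_def pauli_y_def pauli_z_def

lemma qubit_eq_iff: "A = B \<longleftrightarrow> A $ 1 $ 1 = B $ 1 $ 1 \<and> A $ 1 $ 2 = B $ 1 $ 2 \<and>
    A $ 2 $ 1 = B $ 2 $ 1 \<and> A $ 2 $ 2 = (B :: qubit_op) $ 2 $ 2"
  by (auto simp: vec_eq_iff forall_2)

lemma hermitian_pauli: "hermitian (pauli i)"
  by (cases i rule: exhaust_3[THEN disjE]) (auto simp: hermitian_def forall_2 pauli_defs pauli_def)

lemma hermitian_mat_1: "hermitian (mat 1)"
  by (simp add: hermitian_def mat_def)

lemma pauli_y_square: "pauli_y ** pauli_y = mat 1"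
  by (simp add: qubit_eq_iff pauli_defs matrix_matrix_mult_def sum_2 mat_def)

text \<open>This is the one-qubit spin flip, which reverses every Bloch vector.\<close>

lemma conj_flip_pauli: "conj_matrix (pauli_y ** pauli i ** pauli_y) = - pauli i"
proof -
  have "conj_matrix (pauli_y ** P ** pauli_y) = - P" if "P \<in> {pauli_x, pauli_y, pauli_z}" for P
    using that
    by (auto simp: qubit_eq_iff pauli_defs matrix_matrix_mult_def sum_2 conj_matrix_def)
  then show ?thesis by (simp add: pauli_def)
qed

lemma conj_flip_mat_1: "conj_matrix (pauli_y ** mat 1 ** pauli_y) = mat 1"
  by (simp add: pauli_y_square) (simp add: conj_matrix_def mat_def vec_eq_iff)

lemma local_projector_pauli:
  "local_projector s x = (1/2) *\<^sub>R (mat 1 + s *\<^sub>R (\<Sum>i\<in>UNIV. x $ i *\<^sub>R pauli i))"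
  by (simp add: local_projector_def sum_3)

lemma local_projector_entries:
  "local_projector s x $ 1 $ 1 = (1 + of_real (s * x $ 3)) / 2"
  "local_projector s x $ 1 $ 2 = (of_real (s * x $ 1) - \<i> * of_real (s * x $ 2)) / 2"
  "local_projector s x $ 2 $ 1 = (of_real (s * x $ 1) + \<i> * of_real (s * x $ 2)) / 2"
  "local_projector s x $ 2 $ 2 = (1 - of_real (s * x $ 3)) / 2"
  by (simp_all add: local_projector_def pauli_defs mat_def scaleR_conv_of_real[where 'a=complex] algebra_simps)

lemma hermitian_local_projector: "hermitian (local_projector s x)"
  by (simp add: hermitian_def forall_2 local_projector_entries)

lemma local_projector_idem:
  assumes "s\<^sup>2 = 1" "norm x = 1"
  shows "local_projector s x ** local_projector s x = local_projector s x"
proof -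
  have "(x $ 1)\<^sup>2 + (x $ 2)\<^sup>2 + (x $ 3)\<^sup>2 = 1"
    using assms(2) by (simp add: norm_vec_def L2_set_def sum_3)
  then have "(s * x $ 1)\<^sup>2 + (s * x $ 2)\<^sup>2 + (s * x $ 3)\<^sup>2 = 1"
    using assms(1) by (simp add: power_mult_distrib flip: distrib_left)
  then show ?thesis
    by (auto simp: qubit_eq_iff matrix_matrix_mult_def sum_2 local_projector_entries complex_eq_iff
      power2_eq_square field_simps)
qed

lemma trace_local_projector: "trace (local_projector s x) = 1"
  by (simp add: trace_def sum_2 local_projector_entries add_divide_distrib diff_divide_distrib)

lemma trace_local_projector_pauli: "trace (local_projector s x ** pauli i) = of_real (s * x $ i)"
proof -
  have "\<forall>i. trace (local_projector s x ** pauli i) = of_real (s * x $ i)"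
    unfolding forall_3 by (auto simp: trace_def matrix_matrix_mult_def sum_2 local_projector_entries
      pauli_defs field_simps complex_eq_iff)
  then show ?thesis by blast
qed

text \<open>Inside the Bloch ball the operator is a mixture of the two opposite projectors along
  \<open>n\<close>, with weights \<open>(1 + r) / 2\<close> and \<open>(1 - r) / 2\<close>. At the
  centre any direction \<open>n\<close> serves.\<close>

lemma density_local_projector:
  assumes "norm x \<le> 1"
  shows "density_operator (local_projector 1 x)"
proof -
  define r where "r = norm x"
  obtain n where n: "norm n = 1" "x = r *\<^sub>R n"
  proof (cases "x = 0")
    case True
    then show ?thesis using that[of "axis 1 1"] by (simp add: r_def)
  next
    case False
    then show ?thesis using that[of "x /\<^sub>R norm x"] by (simp add: r_def)
  qed
  have "local_projector 1 x = ((1 + r) / 2) *\<^sub>R local_projector 1 n + ((1 - r) / 2) *\<^sub>R local_projector (- 1) n"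
    by (simp add: qubit_eq_iff local_projector_entries n(2) complex_eq_iff field_simps)
  moreover have "pos_semidef (local_projector s n)" if "s\<^sup>2 = 1" for s
    using that n(1) by (intro pos_semidef_projection hermitian_local_projector local_projector_idem)
  ultimately have "pos_semidef (local_projector 1 x)"
    using assms by (auto simp: r_def intro!: pos_semidef_add pos_semidef_scaleR)
  then show ?thesis by (simp add: density_operator_def trace_local_projector)
qed

section \<open>Bloch data of two-qubit operators and the dependence coordinate\<close>

definition bloch_left :: "two_qubit_op \<Rightarrow> real ^ 3"
  where "bloch_left \<rho> = (\<chi> i. Re (trace (\<rho> ** (pauli i \<otimes>\<^sub>m mat 1))))"

definition bloch_right :: "two_qubit_op \<Rightarrow> real ^ 3"
  where "bloch_right \<rho> = (\<chi> i. Re (trace (\<rho> ** (mat 1 \<otimes>\<^sub>m pauli i))))"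

definition bloch_corr :: "two_qubit_op \<Rightarrow> real ^ 3 ^ 3"
  where "bloch_corr \<rho> = (\<chi> i j. Re (trace (\<rho> ** (pauli i \<otimes>\<^sub>m pauli j))))"

lemmas bloch_defs = bloch_left_def bloch_right_def bloch_corr_def

lemma bilinear_trace_kron: "bilinear (\<lambda>A B. Re (trace (\<rho> ** (A \<otimes>\<^sub>m B))))"
  unfolding bilinear_def
  by (intro conjI allI linearI; simp add: kron_add_left kron_add_right kron_scaleR_left
    kron_scaleR_right matrix_add_ldistrib trace_add matrix_mult_scaleR trace_scaleR)

lemma born_prob_bloch:
  assumes "trace \<rho> = 1"
  shows "born_prob \<rho> s t x y = (1 + s * dot (bloch_left \<rho>) x + t * dot (bloch_right \<rho>) y
    + s * t * dot x (bloch_corr \<rho> *v y)) / 4"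
proof -
  define h where "h A B = Re (trace (\<rho> ** (A \<otimes>\<^sub>m B)))" for A B
  have h: "bilinear h" unfolding h_def by (rule bilinear_trace_kron)
  note bil = bilinear_ladd[OF h] bilinear_radd[OF h] bilinear_lmul[OF h] bilinear_rmul[OF h]
  have "h (mat 1) (mat 1) = 1" by (simp add: h_def kron_mat_1 assms)
  moreover have "bloch_left \<rho> $ i = h (pauli i) (mat 1)" "bloch_right \<rho> $ i = h (mat 1) (pauli i)"
    "bloch_corr \<rho> $ i $ j = h (pauli i) (pauli j)" for i j
    by (simp_all add: bloch_defs h_def)
  ultimately show ?thesis
    unfolding born_prob_def h_def[symmetric] local_projector_pauli sum_3 bil
    by (simp add: dot_def matrix_vector_mult_def sum_3 field_simps)
qed

lemma bloch_block_positive: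
  assumes "density_operator \<rho>"
  shows "block_positive (bloch_left \<rho>) (bloch_right \<rho>) (bloch_corr \<rho>)"
  unfolding block_positive_def
proof (intro ballI)
  fix x y :: "real ^ 3" assume "x \<in> sphere 0 1" "y \<in> sphere 0 1"
  then have xy: "norm x = 1" "norm y = 1" by simp_all
  have "0 \<le> born_prob \<rho> 1 1 x y"
    unfolding born_prob_def using assms xy
    by (intro trace_mult_projection_nonneg hermitian_kron hermitian_local_projector)
      (simp_all add: kron_mult local_projector_idem density_operator_def)
  then show "0 \<le> 1 + dot (bloch_left \<rho>) x + dot (bloch_right \<rho>) y + dot x (bloch_corr \<rho> *v y)"
    using assms by (simp add: born_prob_bloch density_operator_def)
qed

abbreviation bloch_cov :: "two_qubit_op \<Rightarrow> real ^ 3 \<Rightarrow> real ^ 3 \<Rightarrow> real"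
  where "bloch_cov \<rho> \<equiv> cov_form (bloch_left \<rho>) (bloch_right \<rho>) (bloch_corr \<rho>)"

abbreviation bloch_dep :: "two_qubit_op \<Rightarrow> real ^ 3 \<Rightarrow> real ^ 3 \<Rightarrow> real"
  where "bloch_dep \<rho> \<equiv> dep_form (bloch_left \<rho>) (bloch_right \<rho>) (bloch_corr \<rho>)"

text \<open>In terms of the Bloch expansion the numerator is the covariance over 4 and the
  denominator is \<open>bloch_dep\<close> over 8, whence the factor 2.\<close>

lemma dep_coord_bloch:
  assumes "trace \<rho> = 1" "norm x = 1" "norm y = 1"
  shows "dep_coord \<rho> x y = 2 * (bloch_cov \<rho> x y / bloch_dep \<rho> x y)"
proof -
  have "dot x x = 1" "dot y y = 1" using assms by (simp_all add: dot_real dot_square_norm)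
  then have "born_prob \<rho> 1 1 x y * born_prob \<rho> (-1) (-1) x y
       - born_prob \<rho> 1 (-1) x y * born_prob \<rho> (-1) 1 x y = bloch_cov \<rho> x y / 4"
    "born_prob \<rho> 1 1 x y * born_prob \<rho> (-1) (-1) x y
       + born_prob \<rho> 1 (-1) x y * born_prob \<rho> (-1) 1 x y = bloch_dep \<rho> x y / 8"
    by (simp_all add: born_prob_bloch assms cov_form_def dep_form_def power2_eq_square field_simps)
  then show ?thesis unfolding dep_coord_def by (simp only:) simp
qed

lemma two_qubit_eq_iff: "A = B \<longleftrightarrow> (\<forall>i j k l. A $ (i, j) $ (k, l) = (B :: two_qubit_op) $ (i, j) $ (k, l))"
  by (auto simp: vec_eq_iff)

lemma trace_mult_kron:
  "trace (\<rho> ** (A \<otimes>\<^sub>m B)) = (\<Sum>i\<in>UNIV. \<Sum>j\<in>UNIV. \<Sum>k\<in>UNIV. \<Sum>l\<in>UNIV. \<rho> $ (i, j) $ (k, l) * (A $ k $ i * B $ l $ j))"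
  by (simp add: trace_def matrix_matrix_mult_def kron_def sum_UNIV_pair)

lemma pauli_separating:
  assumes "trace (W ** mat 1) = 0" "\<And>i. trace (W ** pauli i) = 0"
  shows "W = 0"
  using assms(1) assms(2)[of 1] assms(2)[of 2] assms(2)[of 3]
  by (simp add: trace_def matrix_matrix_mult_def sum_2 pauli_defs mat_def qubit_eq_iff)

text \<open>Pauli tomography: products of Pauli matrices and the identity separate operators, and
  hermiticity ensures that taking \<open>Re\<close> loses nothing. The separation is reduced to one
  qubit at a time.\<close>

lemma hermitian_bloch_eqI:
  assumes h: "hermitian \<rho>" "hermitian \<sigma>" and tr: "trace \<rho> = trace \<sigma>"
    and l: "bloch_left \<rho> = bloch_left \<sigma>" and r: "bloch_right \<rho> = bloch_right \<sigma>"
    and c: "bloch_corr \<rho> = bloch_corr \<sigma>"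
  shows "\<rho> = \<sigma>"
proof -
  define D where "D = \<rho> - \<sigma>"
  define L where "L = insert (mat 1) (range pauli)"
  have L: "hermitian A" if "A \<in> L" for A
    using that hermitian_pauli hermitian_mat_1 by (auto simp: L_def)
  have coords: "Re (trace (\<rho> ** (pauli i \<otimes>\<^sub>m mat 1))) = Re (trace (\<sigma> ** (pauli i \<otimes>\<^sub>m mat 1)))"
    "Re (trace (\<rho> ** (mat 1 \<otimes>\<^sub>m pauli i))) = Re (trace (\<sigma> ** (mat 1 \<otimes>\<^sub>m pauli i)))"
    "Re (trace (\<rho> ** (pauli i \<otimes>\<^sub>m pauli j))) = Re (trace (\<sigma> ** (pauli i \<otimes>\<^sub>m pauli j)))" for i j
    using l r c by (simp_all add: bloch_defs vec_eq_iff)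
  have DL: "trace (D ** (A \<otimes>\<^sub>m B)) = 0" if AB: "A \<in> L" "B \<in> L" for A B
  proof -
    have "trace (\<rho> ** (A \<otimes>\<^sub>m B)) \<in> \<real>" "trace (\<sigma> ** (A \<otimes>\<^sub>m B)) \<in> \<real>"
      using AB h by (auto intro!: hermitian_trace_mult_real hermitian_kron L)
    moreover have "Re (trace (\<rho> ** (A \<otimes>\<^sub>m B))) = Re (trace (\<sigma> ** (A \<otimes>\<^sub>m B)))"
      using AB coords tr by (auto simp: L_def kron_mat_1)
    moreover have "trace (D ** (A \<otimes>\<^sub>m B)) = trace (\<rho> ** (A \<otimes>\<^sub>m B)) - trace (\<sigma> ** (A \<otimes>\<^sub>m B))"
      by (simp add: D_def trace_mult_kron left_diff_distrib sum_subtractf)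
    ultimately show ?thesis by (simp add: complex_is_Real_iff complex_eq_iff)
  qed
  have sep: "W = 0" if "\<And>A. A \<in> L \<Longrightarrow> trace (W ** A) = 0" for W
    by (intro pauli_separating that) (auto simp: L_def)
  \<comment> \<open>\<open>W B\<close> is the partial trace over the second qubit of
    \<open>D\<close> times \<open>mat 1 \<otimes>\<^sub>m B\<close>, and \<open>V i k\<close> is the
    block of \<open>D\<close> with first-qubit indices \<open>i\<close> and \<open>k\<close>.
    One-qubit separation yields \<open>W B = 0\<close> first and then
    \<open>V i k = 0\<close>.\<close>
  define W where "W B = (\<chi> i k. \<Sum>j\<in>UNIV. \<Sum>l\<in>UNIV. D $ (i, j) $ (k, l) * B $ l $ j)" for B :: qubit_op
  define V where "V i k = (\<chi> j l. D $ (i, j) $ (k, l))" for i k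
  have W0: "W B = 0" if "B \<in> L" for B
  proof (rule sep)
    fix A assume "A \<in> L"
    have "trace (W B ** A) = trace (D ** (A \<otimes>\<^sub>m B))"
      unfolding trace_mult_kron
      by (simp add: trace_def matrix_matrix_mult_def W_def sum_2 algebra_simps)
    then show "trace (W B ** A) = 0" using DL \<open>A \<in> L\<close> that by simp
  qed
  have "V i k = 0" for i k
  proof (rule sep)
    fix B assume "B \<in> L"
    have "trace (V i k ** B) = W B $ i $ k"
      by (simp add: trace_def matrix_matrix_mult_def W_def V_def)
    then show "trace (V i k ** B) = 0" using W0 \<open>B \<in> L\<close> by simp
  qed
  then have "V i k $ j $ l = 0" for i j k l by simp
  then have "D = 0" by (simp add: two_qubit_eq_iff V_def)
  then show ?thesis by (simp add: D_def)
qed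

lemma product_state_bloch_cov:
  assumes "product_state \<rho>"
  shows "bloch_cov \<rho> x y = 0"
proof -
  obtain A B where AB: "density_operator A" "density_operator B" "\<rho> = A \<otimes>\<^sub>m B"
    using assms unfolding product_state_def by blast
  have "hermitian A" "hermitian B" and tr: "trace A = 1" "trace B = 1"
    using AB by (auto simp: density_operator_def intro: pos_semidef_hermitian)
  then have "trace (A ** pauli i) \<in> \<real>" "trace (B ** pauli i) \<in> \<real>" for i
    by (auto intro: hermitian_trace_mult_real hermitian_pauli)
  then have "Re (trace (A ** pauli i) * trace (B ** pauli j))
      = Re (trace (A ** pauli i)) * Re (trace (B ** pauli j))" for i j
    by (simp add: complex_is_Real_iff)
  then have "bloch_corr \<rho> $ i $ j = bloch_left \<rho> $ i * bloch_right \<rho> $ j" for i j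
    by (simp add: bloch_defs AB(3) kron_mult trace_kron tr)
  then show ?thesis
    unfolding cov_form_def dot_def matrix_vector_mult_def sum_product
    by (simp add: sum_distrib_left mult_ac)
qed

text \<open>The candidate factors are the one-qubit operators with the marginal Bloch vectors. Zero
  covariance says that the correlations factor, so their product has the same Bloch data as the
  state.\<close>

lemma product_stateI_bloch_cov:
  assumes d: "density_operator \<rho>" and z: "\<And>x y. bloch_cov \<rho> x y = 0"
  shows "product_state \<rho>"
proof -
  note bp = bloch_block_positive[OF d]
  \<comment> \<open>Adding the inequalities for \<open>?y\<close> and \<open>- ?y\<close> leaves
    only the marginal \<open>c\<close>; along \<open>- c\<close> the result is
    \<open>norm c \<le> 1\<close>.\<close>
  have unit: "norm c \<le> 1" if bp: "block_positive c b T" for c b :: "real ^ 3" and T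
  proof (cases "c = 0")
    case False
    let ?x = "- (c /\<^sub>R norm c)" and ?y = "axis 1 1"
    have "norm ?x = 1" using False by simp
    have "0 \<le> 1 + dot c ?x + dot b ?y + dot ?x (T *v ?y)"
      "0 \<le> 1 + dot c ?x + dot b (- ?y) + dot ?x (T *v (- ?y))"
      using bp \<open>norm ?x = 1\<close> unfolding block_positive_def by simp_all
    then have "0 \<le> 1 + dot c ?x" by (simp add: dot_simps mv_minus)
    also have "dot c ?x = - norm c"
      using False by (simp add: dot_real dot_square_norm power2_eq_square)
    finally show ?thesis by simp
  qed simp
  define A where "A = local_projector 1 (bloch_left \<rho>)"
  define B where "B = local_projector 1 (bloch_right \<rho>)"
  have dA: "density_operator A" "density_operator B"
    using unit bp block_positive_transpose unfolding A_def B_def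
    by (blast intro: density_local_projector)+
  have tr: "trace A = 1" "trace B = 1" by (simp_all add: A_def B_def trace_local_projector)
  have "bloch_corr \<rho> $ i $ j = bloch_left \<rho> $ i * bloch_right \<rho> $ j" for i j
  proof -
    have "(bloch_corr \<rho> *v axis j 1) $ i = bloch_corr \<rho> $ i $ j"
      by (rule matrix_mult_axis)
    then show ?thesis
      using z[of "axis i 1" "axis j 1"] by (simp add: cov_form_def dot_commute[of _ "axis _ _"] dot_axis)
  qed
  then have "\<rho> = A \<otimes>\<^sub>m B"
    using d by (intro hermitian_bloch_eqI hermitian_kron)
      (auto simp: density_operator_def A_def B_def hermitian_local_projector bloch_defs kron_mult
        trace_kron trace_local_projector trace_local_projector_pauli vec_eq_iff
        intro: pos_semidef_hermitian)
  then show ?thesis using dA unfolding product_state_def by blast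
qed

section \<open>The double spin flip and determination of the state\<close>

text \<open>Cyclicity moves the flip from the state onto the two observables, where it acts on each
  qubit separately.\<close>

lemma trace_spin_flip_mult_kron:
  "trace (spin_flip \<rho> ** (P \<otimes>\<^sub>m Q))
    = cnj (trace (\<rho> ** (conj_matrix (pauli_y ** P ** pauli_y) \<otimes>\<^sub>m conj_matrix (pauli_y ** Q ** pauli_y))))"
proof -
  let ?Y = "pauli_y \<otimes>\<^sub>m pauli_y"
  have "trace (spin_flip \<rho> ** (P \<otimes>\<^sub>m Q)) = trace (?Y ** (conj_matrix \<rho> ** (?Y ** (P \<otimes>\<^sub>m Q))))"
    by (simp add: spin_flip_def matrix_mul_assoc)
  also have "\<dots> = trace (conj_matrix \<rho> ** (?Y ** (P \<otimes>\<^sub>m Q) ** ?Y))"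
    by (rule trans[OF trace_mul_sym]) (simp add: matrix_mul_assoc)
  also have "\<dots> = trace (conj_matrix (\<rho> ** (conj_matrix (pauli_y ** P ** pauli_y) \<otimes>\<^sub>m conj_matrix (pauli_y ** Q ** pauli_y))))"
    by (simp add: conj_matrix_mult conj_kron kron_mult)
  finally show ?thesis by (simp only: trace_conj)
qed

lemma bloch_spin_flip:
  "bloch_left (spin_flip \<rho>) = - bloch_left \<rho>"
  "bloch_right (spin_flip \<rho>) = - bloch_right \<rho>"
  "bloch_corr (spin_flip \<rho>) = bloch_corr \<rho>"
proof -
  note h = bilinear_trace_kron[of \<rho>]
  show "bloch_left (spin_flip \<rho>) = - bloch_left \<rho>"
    "bloch_right (spin_flip \<rho>) = - bloch_right \<rho>"
    "bloch_corr (spin_flip \<rho>) = bloch_corr \<rho>"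
    unfolding bloch_defs trace_spin_flip_mult_kron conj_flip_pauli conj_flip_mat_1
    by (simp_all add: vec_eq_iff bilinear_lneg[OF h] bilinear_rneg[OF h])
qed

lemma density_spin_flip:
  assumes "density_operator \<rho>"
  shows "density_operator (spin_flip \<rho>)"
proof -
  have "trace (spin_flip \<rho> ** (mat 1 \<otimes>\<^sub>m mat 1)) = cnj (trace (\<rho> ** (mat 1 \<otimes>\<^sub>m mat 1)))"
    by (simp only: trace_spin_flip_mult_kron conj_flip_mat_1)
  then have "trace (spin_flip \<rho>) = 1" using assms by (simp add: kron_mat_1 density_operator_def)
  moreover have "hermitian (pauli_y \<otimes>\<^sub>m pauli_y)"
    using hermitian_kron hermitian_pauli[of 2] by simp
  ultimately show ?thesis
    using assms by (simp add: density_operator_def spin_flip_def pos_semidef_congruence pos_semidef_conj_matrix)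
qed

lemma bloch_cov_spin_flip: "bloch_cov (spin_flip \<rho>) = bloch_cov \<rho>"
  and bloch_dep_spin_flip: "bloch_dep (spin_flip \<rho>) = bloch_dep \<rho>"
  by (simp_all add: fun_eq_iff bloch_spin_flip cov_form_def dep_form_def dot_simps)

text \<open>Among density operators, product states are those with zero covariance, and the
  covariance is even under a joint sign change of both marginals.\<close>

lemma nonproduct_spin_flip: "nonproduct_state \<rho> \<Longrightarrow> nonproduct_state (spin_flip \<rho>)"
  unfolding nonproduct_state_def
  by (metis density_spin_flip product_stateI_bloch_cov product_state_bloch_cov bloch_cov_spin_flip)

lemma dep_coord_determines:
  assumes \<rho>: "nonproduct_state \<rho>" and \<sigma>: "nonproduct_state \<sigma>"
    and eq: "\<forall>x \<in> sphere 0 1. \<forall>y \<in> sphere 0 1. dep_coord \<rho> x y = dep_coord \<sigma> x y"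
  shows "\<sigma> = \<rho> \<or> \<sigma> = spin_flip \<rho>"
proof -
  have d: "density_operator \<rho>" "density_operator \<sigma>"
    using \<rho> \<sigma> by (simp_all add: nonproduct_state_def)
  then have h: "hermitian \<rho>" "hermitian \<sigma>" "hermitian (spin_flip \<rho>)"
    and tr: "trace \<rho> = 1" "trace \<sigma> = 1" "trace (spin_flip \<rho>) = 1"
    using density_spin_flip by (auto simp: density_operator_def intro: pos_semidef_hermitian)
  obtain x0 y0 x1 y1 where nz: "bloch_cov \<rho> x0 y0 \<noteq> 0" "bloch_cov \<sigma> x1 y1 \<noteq> 0"
    using \<rho> \<sigma> product_stateI_bloch_cov unfolding nonproduct_state_def by metis
  have "bloch_corr \<sigma> = bloch_corr \<rho> \<and>
      (bloch_left \<sigma> = bloch_left \<rho> \<and> bloch_right \<sigma> = bloch_right \<rho> \<or>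
       bloch_left \<sigma> = - bloch_left \<rho> \<and> bloch_right \<sigma> = - bloch_right \<rho>)"
  proof (rule dependence_ratio_determines[OF bloch_block_positive[OF d(1)] bloch_block_positive[OF d(2)] nz])
    fix x y :: "real ^ 3" assume xy: "norm x = 1" "norm y = 1"
    then have "dep_coord \<rho> x y = dep_coord \<sigma> x y" using eq by simp
    then show "bloch_cov \<rho> x y / bloch_dep \<rho> x y = bloch_cov \<sigma> x y / bloch_dep \<sigma> x y"
      unfolding dep_coord_bloch[OF tr(1) xy] dep_coord_bloch[OF tr(2) xy]
      by (simp only: mult_cancel_left) simp
  qed
  then show ?thesis
    using hermitian_bloch_eqI[OF h(2,1)] hermitian_bloch_eqI[OF h(2,3)] tr
    by (auto simp: bloch_spin_flip)
qed

theorem theorem1: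
  fixes \<rho> :: two_qubit_op
  assumes "nonproduct_state \<rho>"
  shows "(\<forall>\<sigma>. nonproduct_state \<sigma> \<longrightarrow>
            (\<forall>x \<in> sphere 0 1. \<forall>y \<in> sphere 0 1. dep_coord \<rho> x y = dep_coord \<sigma> x y) \<longrightarrow>
            \<sigma> = \<rho> \<or> \<sigma> = spin_flip \<rho>) \<and>
         {\<sigma>. nonproduct_state \<sigma> \<and>
            (\<forall>x \<in> sphere 0 1. \<forall>y \<in> sphere 0 1. dep_coord \<sigma> x y = dep_coord \<rho> x y)}
           = {\<rho>, spin_flip \<rho>}"
proof -
  have tr: "trace \<rho> = 1" "trace (spin_flip \<rho>) = 1"
    using assms nonproduct_spin_flip[OF assms]
    by (simp_all add: nonproduct_state_def density_operator_def)
  \<comment> \<open>This, together with \<open>nonproduct_spin_flip\<close>, shows that the flipped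
    state lies in the same fibre, giving the converse inclusion of the set equality.\<close>
  have flip: "dep_coord (spin_flip \<rho>) x y = dep_coord \<rho> x y"
    if "x \<in> sphere 0 1" "y \<in> sphere 0 1" for x y
    using that tr by (simp add: dep_coord_bloch bloch_cov_spin_flip bloch_dep_spin_flip)
  show ?thesis
  proof (intro conjI allI impI)
    fix \<sigma> assume "nonproduct_state \<sigma>"
      "\<forall>x \<in> sphere 0 1. \<forall>y \<in> sphere 0 1. dep_coord \<rho> x y = dep_coord \<sigma> x y"
    then show "\<sigma> = \<rho> \<or> \<sigma> = spin_flip \<rho>" by (rule dep_coord_determines[OF assms])
  next
    show "{\<sigma>. nonproduct_state \<sigma> \<and>
        (\<forall>x \<in> sphere 0 1. \<forall>y \<in> sphere 0 1. dep_coord \<sigma> x y = dep_coord \<rho> x y)} = {\<rho>, spin_flip \<rho>}"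
    proof (intro set_eqI iffI)
      fix \<sigma> assume "\<sigma> \<in> {\<sigma>. nonproduct_state \<sigma> \<and>
        (\<forall>x \<in> sphere 0 1. \<forall>y \<in> sphere 0 1. dep_coord \<sigma> x y = dep_coord \<rho> x y)}"
      then show "\<sigma> \<in> {\<rho>, spin_flip \<rho>}" using dep_coord_determines[OF assms, of \<sigma>] by auto
    next
      fix \<sigma> assume "\<sigma> \<in> {\<rho>, spin_flip \<rho>}"
      then show "\<sigma> \<in> {\<sigma>. nonproduct_state \<sigma> \<and>
        (\<forall>x \<in> sphere 0 1. \<forall>y \<in> sphere 0 1. dep_coord \<sigma> x y = dep_coord \<rho> x y)}"
        using assms nonproduct_spin_flip[OF assms] flip by auto
    qed
  qed
qed

end
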